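(* Let $\ell$ be a positive integer with $q-1=\ell s$. For all $i=0,\ldots,\ell-1$, let $r_i,k_i,e_i,t_i$ be positive integers such that $\gcd(\ell,e_i)=1$, and let $h_{k_i}(x)=1+x+\cdots+x^{k_i}$. Suppose $q=q_0^m$ such that $q_0\equiv 1\pmod{\ell}$ and $\ell\mid m$. Define $P:\mathbb{F}_q\to\mathbb{F}_q$ by $P(0)=0$ and $P(x)=x^{r_i}h_{k_i}(x^{e_is})^{t_i}$ if $x\in C_i$, for $0\le i\le\ell-1$. Then $P$ permutes $\mathbb{F}_q$ if and only if $\{r_ii\mid i=0,\ldots,\ell-1\}$ is a complete set of residues modulo $\ell$, $\gcd(r_i,s)=1$ for all $0\le i\le\ell-1$, $p\nmid k_0+1$, and $\ell\nmid i(k_i+1)$ for all $i=1,\ldots,\ell-1$.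
   Context: $q_0$ and $q$ are powers of a prime $p$ (the characteristic of $\mathbb{F}_q$) and $m$ is a positive integer. $\gamma$ is a fixed primitive element (generator of $\mathbb{F}_q^*$). $C_0=\{\gamma^{\ell j}: 0\le j\le s-1\}$ and $C_i=\gamma^iC_0$ for $0\le i\le\ell-1$ are the cyclotomic cosets. *)

theory Defs
  imports "HOL-Number_Theory.Number_Theory" "HOL-Computational_Algebra.Polynomial"
    "HOL-Library.Cardinality"
begin

(* In a finite field every power of gamma with integer exponent is also a power with
   exponent in nat, so this says that gamma generates the multiplicative group. *)
definition primitive_element :: "'a::{finite,field} \<Rightarrow> bool" where
  "primitive_element \<gamma> \<longleftrightarrow> range (\<lambda>n::nat. \<gamma> ^ n) = UNIV - {0}"

definition cyclotomic_coset0 :: "'a::{finite,field} \<Rightarrow> nat \<Rightarrow> nat \<Rightarrow> 'a set" where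
  "cyclotomic_coset0 \<gamma> l s = {\<gamma> ^ (l * j) | j. j < s}"

definition cyclotomic_coset :: "'a::{finite,field} \<Rightarrow> nat \<Rightarrow> nat \<Rightarrow> nat \<Rightarrow> 'a set" where
  "cyclotomic_coset \<gamma> l s i = (\<lambda>x. \<gamma> ^ i * x) ` cyclotomic_coset0 \<gamma> l s"

definition h_poly :: "nat \<Rightarrow> 'a::{finite,field} poly" where
  "h_poly k = (\<Sum>j\<le>k. monom 1 j)"

definition complete_residue_set :: "nat \<Rightarrow> int set \<Rightarrow> bool" where
  "complete_residue_set l A \<longleftrightarrow> (\<forall>a. \<exists>!x. x \<in> A \<and> [x = a] (mod int l))"

end

theory Submission
  imports Defs
begin

text \<open>
  On $C_i$ the argument $x^{e_i s}$ is the constant $\omega^{e_i i}$, where $\omega = \gamma^s$ has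
  order $\ell$, so $P(x) = c_i x^{r_i}$ there, with $c_i = h_{k_i}(\omega^{e_i i})^{t_i}$.
  Since $q_0 \equiv 1 \pmod \ell$, both $\omega$ and $c_i$ lie in $\mathbb{F}_{q_0}$, and
  $\ell \mid m$ forces $(q_0 - 1) \mid s$; thus a nonzero $c_i$ satisfies $c_i^s = 1$, i.e.
  $c_i \in C_0$. Comparing exponents of $\gamma$, such a map sends $C_i$ to $C_{r_i i}$ and
  acts on exponents within a coset as an affine map modulo $s$ with slope $r_i$.
\<close>

section \<open>Powers of a primitive element\<close>

lemma primitive_element_nonzero: "primitive_element \<gamma> \<Longrightarrow> \<gamma> \<noteq> 0"
  unfolding primitive_element_def using rangeI[of "\<lambda>n. \<gamma> ^ n" 1] by auto

lemma primitive_element_obtain_exponent: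
  assumes "primitive_element \<gamma>" "x \<noteq> 0"
  obtains n where "x = \<gamma> ^ n"
  using assms unfolding primitive_element_def by blast

text \<open>Since the field is finite, two powers coincide, so a least positive exponent d with
  value 1 exists. Exponents then matter only modulo d and the first d powers are distinct; they
  exhaust the nonzero elements, so d is \<open>CARD('a) - 1\<close>.\<close>

lemma primitive_element_power_eq_iff:
  fixes \<gamma> :: "'a::{finite,field}"
  assumes prim: "primitive_element \<gamma>"
  shows "\<gamma> ^ a = \<gamma> ^ b \<longleftrightarrow> [a = b] (mod (CARD('a) - 1))"
proof -
  have nz: "\<gamma> \<noteq> 0" using prim by (rule primitive_element_nonzero)
  have diff: "\<gamma> ^ (v - u) = 1" if "\<gamma> ^ u = \<gamma> ^ v" "u \<le> v" for u v
    using that nz by (simp add: power_diff)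
  have "\<not> inj (\<lambda>n::nat. \<gamma> ^ n)"
    using finite_imageD[of "\<lambda>n::nat. \<gamma> ^ n" UNIV] by auto
  then obtain u v where "u < v" "\<gamma> ^ u = \<gamma> ^ v"
    unfolding inj_def by (metis linorder_neqE_nat)
  then have ex: "\<exists>n. n > 0 \<and> \<gamma> ^ n = 1"
    using diff by (intro exI[of _ "v - u"]) auto
  define d where "d = (LEAST n. n > 0 \<and> \<gamma> ^ n = 1)"
  have d: "d > 0" "\<gamma> ^ d = 1"
    using LeastI_ex[OF ex] unfolding d_def by auto
  have d_min: "d \<le> n" if "n > 0" "\<gamma> ^ n = 1" for n
    unfolding d_def by (rule Least_le) (use that in auto)
  have red: "\<gamma> ^ n = \<gamma> ^ (n mod d)" for n
  proof -
    have "\<gamma> ^ n = \<gamma> ^ (d * (n div d) + n mod d)" by simp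
    also have "\<dots> = \<gamma> ^ (n mod d)" using d by (simp only: power_add power_mult) simp
    finally show ?thesis .
  qed
  have le: "v \<le> u" if "u < d" "v < d" "\<gamma> ^ u = \<gamma> ^ v" for u v
    using diff[OF that(3)] d_min[of "v - u"] that by linarith
  have inj: "inj_on (\<lambda>n. \<gamma> ^ n) {..<d}"
    by (rule inj_onI) (use le in \<open>force intro: le_antisym\<close>)
  have "range (\<lambda>n. \<gamma> ^ n) = (\<lambda>n. \<gamma> ^ n) ` {..<d}"
  proof (intro equalityI subsetI)
    fix x assume "x \<in> range (\<lambda>n. \<gamma> ^ n)"
    then obtain n where "x = \<gamma> ^ (n mod d)" using red by blast
    then show "x \<in> (\<lambda>n. \<gamma> ^ n) ` {..<d}" using d by auto
  qed auto
  then have "CARD('a) - 1 = d"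
    using prim card_image[OF inj] by (simp add: primitive_element_def card_Diff_singleton)
  moreover have "\<gamma> ^ a = \<gamma> ^ b \<longleftrightarrow> a mod d = b mod d"
    using red[of a] red[of b] inj d by (auto simp: inj_on_def)
  ultimately show ?thesis by (simp add: cong_def)
qed

section \<open>Residue systems and maps that are affine on exponents\<close>

lemma complete_residue_set_iff_inj_on:
  assumes "l > 0"
  shows "complete_residue_set l {int (f i) | i. i < l} \<longleftrightarrow> inj_on (\<lambda>i. f i mod l) {..<l}"
proof
  let ?g = "\<lambda>i. f i mod l"
  assume complete: "complete_residue_set l {int (f i) | i. i < l}"
  \<comment> \<open>Only existence is used here: \<open>l\<close> indices that reach all
    \<open>l\<close> classes reach each exactly once. Hence no two values \<open>f i\<close> can
    have merged in the set of integers.\<close>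
  have "{..<l} \<subseteq> ?g ` {..<l}"
  proof
    fix a assume "a \<in> {..<l}"
    moreover obtain i where "i < l" "[int (f i) = int a] (mod int l)"
      using complete unfolding complete_residue_set_def by blast
    ultimately have "i < l" "a = f i mod l"
      unfolding cong_int_iff by (simp_all add: cong_def)
    then show "a \<in> ?g ` {..<l}" by blast
  qed
  then show "inj_on ?g {..<l}"
    by (intro finite_surj_inj) auto
next
  let ?g = "\<lambda>i. f i mod l"
  assume inj: "inj_on ?g {..<l}"
  then have surj: "?g ` {..<l} = {..<l}"
    by (intro endo_inj_surj) (use assms in auto)
  show "complete_residue_set l {int (f i) | i. i < l}"
    unfolding complete_residue_set_def
  proof
    fix a :: int
    have "nat (a mod int l) \<in> ?g ` {..<l}"
      unfolding surj using assms by (simp add: nat_less_iff)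
    then obtain i where i: "i < l" "nat (a mod int l) = f i mod l" by auto
    then have "int (f i) mod int l = a mod int l"
      using assms by (metis nat_0_le of_nat_0_less_iff pos_mod_sign zmod_int)
    then have ca: "[int (f i) = a] (mod int l)" by (simp add: cong_def)
    show "\<exists>!x. x \<in> {int (f i) | i. i < l} \<and> [x = a] (mod int l)"
    proof (rule ex1I[of _ "int (f i)"])
      fix x assume x: "x \<in> {int (f i) | i. i < l} \<and> [x = a] (mod int l)"
      then obtain j where j: "j < l" "x = int (f j)" by auto
      then have "[int (f j) = int (f i)] (mod int l)"
        using x ca by (simp add: cong_def)
      then have "f j mod l = f i mod l" unfolding cong_int_iff by (simp add: cong_def)
      then have "j = i" using inj i(1) j(1) by (auto dest: inj_onD)
      then show "x = int (f i)" using j by simp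
    qed (use i ca in auto)
  qed
qed

text \<open>Separates the counting on exponents from the arithmetic of the polynomials. Each
  constant enters only as some element \<open>\<gamma> ^ (l * b i)\<close> of C_0: it shifts
  positions inside the target coset, so \<open>b\<close> is arbitrary and absent from the
  criterion.\<close>

lemma bij_iff_on_cyclotomic_cosets:
  fixes \<gamma> :: "'a::{finite,field}"
  assumes prim: "primitive_element \<gamma>" and card: "CARD('a) - 1 = l * s" and "l > 0" "s > 0"
    and P0: "P 0 = 0"
    and P: "\<And>i j. i < l \<Longrightarrow> j < s \<Longrightarrow> P (\<gamma> ^ (i + l * j)) = \<gamma> ^ (l * b i) * (\<gamma> ^ (i + l * j)) ^ r i"
  shows "bij P \<longleftrightarrow> complete_residue_set l {int (r i * i) | i. i < l} \<and> (\<forall>i<l. gcd (r i) s = 1)"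
proof -
  have eq_iff: "\<gamma> ^ a = \<gamma> ^ b \<longleftrightarrow> [a = b] (mod (l * s))" for a b
    using primitive_element_power_eq_iff[OF prim] card by simp
  have nz: "\<gamma> \<noteq> 0" using prim by (rule primitive_element_nonzero)
  have Pexp: "P (\<gamma> ^ (i + l * j)) = \<gamma> ^ (r i * i + l * (r i * j + b i))" if "i < l" "j < s" for i j
    unfolding P[OF that] by (simp add: power_add[symmetric] power_mult[symmetric] algebra_simps)
  have coset: "\<exists>i<l. \<exists>j<s. x = \<gamma> ^ (i + l * j)" if x: "x \<noteq> 0" for x
  proof -
    obtain n where n: "x = \<gamma> ^ n" by (rule primitive_element_obtain_exponent[OF prim x])
    \<comment> \<open>Mixed-radix digits of the exponent: the remainder modulo \<open>l\<close>
      selects the coset, the next digit the position in it.\<close>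
    have "n mod (l * s) = n mod l + l * (n div l mod s)" by (simp add: mod_mult2_eq)
    then have "x = \<gamma> ^ (n mod l + l * (n div l mod s))"
      unfolding n eq_iff by (metis cong_mod_right cong_refl)
    moreover have "n mod l < l" "n div l mod s < s" using \<open>l > 0\<close> \<open>s > 0\<close> by simp_all
    ultimately show ?thesis by blast
  qed
  have mod_l: "[i + l * u = i' + l * u'] (mod (l * s)) \<Longrightarrow> i mod l = i' mod l" for i i' u u'
    using cong_dvd_modulus_nat[of "i + l * u" "i' + l * u'" "l * s" l] by (simp add: cong_def)
  show ?thesis unfolding complete_residue_set_iff_inj_on[OF \<open>l > 0\<close>]
  proof safe
    assume bij: "bij P"
    have "{..<l} \<subseteq> (\<lambda>i. r i * i mod l) ` {..<l}"
    proof
      fix a assume a: "a \<in> {..<l}"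
      obtain x where x: "P x = \<gamma> ^ a" using bij unfolding bij_def surj_def by metis
      then have "x \<noteq> 0" using P0 nz by auto
      then obtain i j where ij: "i < l" "j < s" "x = \<gamma> ^ (i + l * j)" using coset by blast
      have "\<gamma> ^ (r i * i + l * (r i * j + b i)) = \<gamma> ^ (a + l * 0)"
        using x Pexp[OF ij(1,2)] ij(3) by simp
      then have "r i * i mod l = a mod l" unfolding eq_iff by (rule mod_l)
      then show "a \<in> (\<lambda>i. r i * i mod l) ` {..<l}"
        using a ij by (intro image_eqI[of _ _ i]) auto
    qed
    then show "inj_on (\<lambda>i. r i * i mod l) {..<l}"
      by (intro finite_surj_inj) auto
  next
    fix i assume bij: "bij P" and i: "i < l"
    \<comment> \<open>With g the gcd, v = s / g is a collision witness: r_i v is a multiple of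
      \<open>s\<close>, so positions v and 0 of the coset have the same image, although 0 < v < s
      when g > 1.\<close>
    define g where "g = gcd (r i) s"
    obtain v where v: "s = g * v" unfolding g_def by (meson dvdE gcd_dvd2)
    obtain w where w: "r i = g * w" unfolding g_def by (meson dvdE gcd_dvd1)
    have "v > 0" using v \<open>s > 0\<close> by (cases v) auto
    show "gcd (r i) s = 1"
    proof (rule ccontr)
      assume "gcd (r i) s \<noteq> 1"
      moreover have "g > 0" using v \<open>s > 0\<close> by (cases g) auto
      ultimately have "g > 1" unfolding g_def by linarith
      then have "v < s" using v \<open>v > 0\<close> by simp
      have "r i * v = s * w" by (simp add: v w)
      then have "r i * i + l * (r i * v + b i) = r i * i + l * (r i * 0 + b i) + l * s * w"
        by (simp add: distrib_left)
      then have "P (\<gamma> ^ (i + l * v)) = P (\<gamma> ^ (i + l * 0))"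
        unfolding Pexp[OF i \<open>v < s\<close>] Pexp[OF i \<open>s > 0\<close>] eq_iff
        by (simp only: cong_def mod_mult_self2)
      then have "\<gamma> ^ (i + l * v) = \<gamma> ^ (i + l * 0)"
        using bij by (simp add: bij_def inj_eq)
      then have "[l * v = 0] (mod (l * s))"
        unfolding eq_iff by (simp add: cong_add_lcancel_0_nat)
      then have "s dvd v" using \<open>l > 0\<close> by (simp add: cong_0_iff)
      then show False using \<open>v < s\<close> \<open>v > 0\<close> by (auto dest: dvd_imp_le)
    qed
  next
    assume inj: "inj_on (\<lambda>i. r i * i mod l) {..<l}" and cop: "\<forall>i<l. gcd (r i) s = 1"
    have P_nz: "P x \<noteq> 0" if "x \<noteq> 0" for x
      using coset[OF that] Pexp nz by auto
    have "inj P"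
    proof (rule injI)
      fix x y assume eq: "P x = P y"
      show "x = y"
      proof (cases "x = 0 \<or> y = 0")
        case True
        then show ?thesis using eq P0 P_nz by metis
      next
        case False
        then obtain i j i' j' where ij: "i < l" "j < s" "x = \<gamma> ^ (i + l * j)"
          and ij': "i' < l" "j' < s" "y = \<gamma> ^ (i' + l * j')"
          using coset by meson
        \<comment> \<open>Read modulo \<open>l\<close>, this congruence identifies the coset; after
          cancelling \<open>l\<close>, it identifies the position modulo \<open>s\<close>.\<close>
        have c: "[r i * i + l * (r i * j + b i) = r i' * i' + l * (r i' * j' + b i')] (mod (l * s))"
          using eq Pexp[OF ij(1,2)] Pexp[OF ij'(1,2)] ij(3) ij'(3) eq_iff by simp
        then have "r i * i mod l = r i' * i' mod l" by (rule mod_l)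
        then have "i = i'" using inj ij(1) ij'(1) by (auto dest: inj_onD)
        have "[l * (r i * j + b i) = l * (r i * j' + b i)] (mod (l * s))"
          using c unfolding \<open>i = i'\<close> cong_add_lcancel_nat .
        then have "[r i * j + b i = r i * j' + b i] (mod s)"
          using \<open>l > 0\<close> by (simp add: cong_def mult_mod_right[symmetric])
        then have "[r i * j = r i * j'] (mod s)" by (simp add: cong_add_rcancel_nat)
        moreover have "coprime (r i) s" using cop ij(1) by (blast intro: gcd_eq_1_imp_coprime)
        ultimately have "[j = j'] (mod s)" using cong_mult_lcancel_nat by blast
        then show ?thesis using ij ij' \<open>i = i'\<close> by (simp add: cong_def)
      qed
    qed
    then show "bij P" by (simp add: bij_def finite_UNIV_inj_surj)
  qed
qed

section \<open>Values of \<open>h_poly\<close> and divisibility for the subfield of order q0\<close>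

lemma poly_h_poly: "poly (h_poly k) x = (\<Sum>j\<le>k. x ^ j)"
  by (simp add: h_poly_def poly_sum poly_monom)

text \<open>Geometric sum, with the nonzero factor 1 - x cancelled. At the excluded point x = 1 the
  value is k + 1, which is why index 0 gets its own condition in the final criterion.\<close>

lemma poly_h_poly_eq_0_iff:
  assumes "x \<noteq> 1"
  shows "poly (h_poly k) x = 0 \<longleftrightarrow> x ^ (k + 1) = 1"
proof -
  have "(1 - x) * poly (h_poly k) x = 1 - x ^ (k + 1)"
    using sum_gp_basic[of x k] by (simp add: poly_h_poly)
  then show ?thesis using assms by (metis right_minus_eq mult_eq_0_iff)
qed

text \<open>The n-th power map is an iterated Frobenius, hence additive, and it fixes every power of
  \<open>x\<close>.\<close>

lemma poly_h_poly_power_eq_same: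
  fixes x :: "'a::{finite,field}"
  assumes "prime CHAR('a)" "n = CHAR('a) ^ b" "x ^ n = x"
  shows "poly (h_poly k) x ^ n = poly (h_poly k) x"
proof -
  have "(x ^ j) ^ n = x ^ j" for j
    using assms(3) by (metis power_commutes power_mult mult.commute)
  then show ?thesis
    by (simp add: poly_h_poly freshmans_dream_sum'[OF assms(1,2)])
qed

text \<open>Factor n^m - 1 = (n - 1) S with S = 1 + n + ... + n^(m-1). Modulo \<open>l\<close> every
  term is 1, so S is congruent to \<open>m\<close>, hence to 0, and \<open>l\<close> cancels from l
  s = (n - 1) S.\<close>

lemma pred_dvd_cofactor:
  fixes n :: nat
  assumes "[n = 1] (mod l)" "l dvd m" "n ^ m - 1 = l * s" "l > 0" "n > 0"
  shows "n - 1 dvd s"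
proof -
  define S where "S = (\<Sum>i<m. n ^ i)"
  have "[S = (\<Sum>i<m. 1)] (mod l)"
    unfolding S_def using assms(1) by (intro cong_sum) (metis cong_pow power_one)
  then have "l dvd S" using assms(2) by (simp add: cong_dvd_iff)
  then obtain u where u: "S = l * u" by blast
  have "int (n ^ m) - 1 = (int n - 1) * int S"
    unfolding S_def using power_diff_1_eq[of "int n" m] by simp
  then have "int (n ^ m - 1) = int ((n - 1) * S)"
    using assms(5) by (simp add: of_nat_diff)
  then have "l * s = (n - 1) * (l * u)" using assms(3) u by (simp only: of_nat_eq_iff)
  then have "l * s = l * ((n - 1) * u)" by (simp add: ac_simps)
  then have "s = (n - 1) * u" using assms(4) by simp
  then show ?thesis by simp
qed

section \<open>The constants of P on the cosets and the permutation criterion\<close>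

theorem corollary3p5:
  fixes \<gamma> :: "'a::{finite,field}"
    and P :: "'a \<Rightarrow> 'a"
    and p q q0 m l s :: nat
    and r k e t :: "nat \<Rightarrow> nat"
  assumes "prime p" and "CHAR('a) = p"
    and "q = CARD('a)"
    and "\<exists>a>0. q = p ^ a"
    and "\<exists>b>0. q0 = p ^ b"
    and "m > 0"
    and "primitive_element \<gamma>"
    and "l > 0" and "q - 1 = l * s"
    and "\<And>i. i < l \<Longrightarrow> r i > 0 \<and> k i > 0 \<and> e i > 0 \<and> t i > 0"
    and "\<And>i. i < l \<Longrightarrow> gcd l (e i) = 1"
    and "q = q0 ^ m" and "[q0 = 1] (mod l)" and "l dvd m"
    and "P 0 = 0"
    and "\<And>i x. i < l \<Longrightarrow> x \<in> cyclotomic_coset \<gamma> l s i \<Longrightarrow>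
           P x = x ^ r i * poly (h_poly (k i)) (x ^ (e i * s)) ^ t i"
  shows "bij P \<longleftrightarrow>
           complete_residue_set l {int (r i * i) | i. i < l} \<and>
           (\<forall>i<l. gcd (r i) s = 1) \<and>
           \<not> p dvd k 0 + 1 \<and>
           (\<forall>i\<in>{1..<l}. \<not> l dvd i * (k i + 1))"
proof -
  note prim = assms(7)
  have card: "CARD('a) - 1 = l * s" using assms(3,9) by simp
  have "CARD('a) > 1"
    using card_mono[of "UNIV :: 'a set" "{0, 1}"] by simp
  then have "s > 0" using card by (cases s) auto
  have nz: "\<gamma> \<noteq> 0" using prim by (rule primitive_element_nonzero)
  have eq_iff: "\<gamma> ^ a = \<gamma> ^ b \<longleftrightarrow> [a = b] (mod (l * s))" for a b
    using primitive_element_power_eq_iff[OF prim] card by simp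
  define \<omega> where "\<omega> = \<gamma> ^ s"
  have \<omega>_eq_iff: "\<omega> ^ a = \<omega> ^ b \<longleftrightarrow> [a = b] (mod l)" for a b
    unfolding \<omega>_def power_mult[symmetric] eq_iff using \<open>s > 0\<close>
    by (simp add: cong_def mult.commute[of l] mult_mod_right[symmetric])
  have \<omega>_eq_1: "\<omega> ^ a = 1 \<longleftrightarrow> l dvd a" for a
    using \<omega>_eq_iff[of a 0] by (simp add: cong_0_iff)
  \<comment> \<open>The constant c_i is \<open>H i ^ t i\<close>; as \<open>t i\<close> is positive
    for i < l, it vanishes exactly when \<open>H i\<close> does.\<close>
  define H where "H i = poly (h_poly (k i)) (\<omega> ^ (e i * i))" for i
  have P: "P (\<gamma> ^ (i + l * j)) = H i ^ t i * (\<gamma> ^ (i + l * j)) ^ r i" if "i < l" "j < s" for i j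
  proof -
    have "\<gamma> ^ (i + l * j) \<in> cyclotomic_coset \<gamma> l s i"
      unfolding cyclotomic_coset_def cyclotomic_coset0_def using that by (auto simp: power_add)
    moreover have "(\<gamma> ^ (i + l * j)) ^ (e i * s) = \<omega> ^ (e i * i)"
    proof -
      have "(i + l * j) * (e i * s) = s * (e i * i) + l * s * (j * e i)"
        by (simp add: algebra_simps)
      then show ?thesis
        unfolding \<omega>_def power_mult[symmetric] eq_iff by (simp only: cong_def mod_mult_self2)
    qed
    ultimately show ?thesis using assms(16)[OF that(1)] unfolding H_def by simp
  qed
  have H0: "H 0 = 0 \<longleftrightarrow> p dvd k 0 + 1"
  proof -
    have "H 0 = of_nat (k 0 + 1)" unfolding H_def by (simp add: poly_h_poly)
    then show ?thesis using assms(2) by (metis of_nat_eq_0_iff_char_dvd)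
  qed
  have Hi: "H i = 0 \<longleftrightarrow> l dvd i * (k i + 1)" if "i \<in> {1..<l}" for i
  proof -
    have i: "0 < i" "i < l" using that by auto
    \<comment> \<open>Coprimality serves twice: it keeps the argument of \<open>h_poly\<close>
      different from 1, so the geometric sum applies, and it then drops \<open>e i\<close> from the
      divisibility condition.\<close>
    have cop: "coprime l (e i)" using assms(11)[OF i(2)] by (rule gcd_eq_1_imp_coprime)
    have "\<not> l dvd e i * i"
      using cop i by (auto simp: coprime_dvd_mult_right_iff dest: dvd_imp_le)
    then have "\<omega> ^ (e i * i) \<noteq> 1" using \<omega>_eq_1 by blast
    from poly_h_poly_eq_0_iff[OF this, of "k i"]
    have "H i = 0 \<longleftrightarrow> \<omega> ^ (e i * (i * (k i + 1))) = 1"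
      by (simp only: H_def power_mult[symmetric] mult.assoc)
    then show ?thesis
      unfolding \<omega>_eq_1 using cop by (simp only: coprime_dvd_mult_right_iff)
  qed
  have H_coset0: "\<exists>b. H i ^ t i = \<gamma> ^ (l * b)" if Hi_nz: "H i \<noteq> 0" for i
  proof -
    obtain b where q0: "q0 = CHAR('a) ^ b" using assms(2,5) by auto
    have "q0 > 0" using q0 assms(1,2) by (simp add: prime_gt_0_nat)
    \<comment> \<open>As \<omega> has order \<open>l\<close> and q0 is 1 modulo \<open>l\<close>,
      raising to the power q0 fixes powers of \<omega>, and therefore \<open>H i\<close>.\<close>
    have "(\<omega> ^ (e i * i)) ^ q0 = \<omega> ^ (e i * i)"
      unfolding power_mult[symmetric] \<omega>_eq_iff
      using cong_scalar_left[OF assms(13), of "e i * i"] by simp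
    then have "H i ^ q0 = H i"
      unfolding H_def using assms(1,2) q0 by (intro poly_h_poly_power_eq_same) auto
    then have "H i ^ (q0 - 1) = 1"
      using Hi_nz \<open>q0 > 0\<close> by (simp add: power_diff)
    moreover have "q0 - 1 dvd s"
      using assms(8,9,12,13,14) \<open>q0 > 0\<close> by (intro pred_dvd_cofactor[of q0 l m s]) auto
    ultimately have "H i ^ s = 1" by (auto elim!: dvdE simp: power_mult)
    then have *: "(H i ^ t i) ^ s = 1" by (metis mult.commute power_mult power_one)
    obtain n where n: "H i ^ t i = \<gamma> ^ n"
      using primitive_element_obtain_exponent[OF prim power_not_zero[OF Hi_nz]] by blast
    \<comment> \<open>The s-th power of \<open>\<gamma> ^ n\<close> is \<open>\<omega> ^ n\<close>,
      which is 1 only if \<open>l\<close> divides n.\<close>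
    have "l dvd n" using * \<omega>_eq_1[of n] unfolding n \<omega>_def by (simp add: power_mult[symmetric] mult.commute)
    then show ?thesis using n by blast
  qed
  have H_all: "(\<forall>i<l. H i \<noteq> 0) \<longleftrightarrow>
      \<not> p dvd k 0 + 1 \<and> (\<forall>i\<in>{1..<l}. \<not> l dvd i * (k i + 1))" (is "?L \<longleftrightarrow> ?R")
  proof
    show "?L \<Longrightarrow> ?R" using H0 Hi assms(8) by auto
    show "?R \<Longrightarrow> ?L" using H0 Hi by (metis Suc_leI One_nat_def atLeastLessThan_iff gr0I)
  qed
  show ?thesis
  proof (cases "\<forall>i<l. H i \<noteq> 0")
    case True
    then have "\<forall>i. \<exists>b. i < l \<longrightarrow> H i ^ t i = \<gamma> ^ (l * b)" using H_coset0 by blast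
    then obtain b where "\<And>i. i < l \<Longrightarrow> H i ^ t i = \<gamma> ^ (l * b i)" by metis
    then have "bij P \<longleftrightarrow>
        complete_residue_set l {int (r i * i) | i. i < l} \<and> (\<forall>i<l. gcd (r i) s = 1)"
      by (intro bij_iff_on_cyclotomic_cosets[OF prim card, where b = b])
        (simp_all add: P \<open>l > 0\<close> \<open>s > 0\<close> \<open>P 0 = 0\<close>)
    then show ?thesis using True H_all by blast
  next
    case False
    then obtain i where i: "i < l" "H i = 0" by blast
    \<comment> \<open>A vanishing constant, still 0 after the positive power \<open>t i\<close>,
      gives P the nonzero root \<open>\<gamma> ^ i\<close> besides 0.\<close>
    then have "P (\<gamma> ^ (i + l * 0)) = P 0"
      using P[of i 0] \<open>s > 0\<close> assms(10)[OF i(1)] \<open>P 0 = 0\<close> by simp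
    then have "\<not> bij P" using nz by (auto simp: bij_def inj_eq)
    then show ?thesis using False H_all by blast
  qed
qed

end
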